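(* Let $T$ be a truss and let $M$ be a left $T$-module. Then, for all $e\in M$, the set $T\times M$ is a truss with the Cartesian product heap structure $[(t,m),(t',m'),(t'',m'')]=([t,t',t''],[m,m',m''])$ and multiplication $$(t,m)(t',m')=(tt',[m,t\cdot e,t\cdot m']),$$ for all $t,t'\in T$ and $m,m'\in M$. (This truss is denoted $T[M;e]$ and called an extension of $T$ by $M$.)
   Context: A heap is a set $H$ with a ternary operation $[-,-,-]$ such that $[[a,b,c],d,e]=[a,b,[c,d,e]]$ and $[b,b,a]=a=[a,b,b]$; it is abelian if $[a,b,c]=[c,b,a]$. A truss is an abelian heap $T$ with an associative binary multiplication such that $a[b,c,d]=[ab,ac,ad]$ and $[b,c,d]a=[ba,ca,da]$ for all $a,b,c,d\in T$. A left $T$-module is an abelian heap $M$ with an action $T\times M\to M$, $(t,m)\mapsto t\cdot m$, such that $t\cdot(t'\cdot m)=(tt')\cdot m$, $[t,t',t'']\cdot m=[t\cdot m,t'\cdot m,t''\cdot m]$ and $t\cdot[m,m',m'']=[t\cdot m,t\cdot m',t\cdot m'']$. *)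

theory Defs
  imports Main
begin

text \<open>
  All structures live on carrier sets, so closure of each operation is stated explicitly and the
  axioms are restricted to the carrier. Carriers may be empty: the heap axioms
  do not exclude the empty heap.
\<close>

locale heap =
  fixes H :: "'a set"
    and br :: "'a \<Rightarrow> 'a \<Rightarrow> 'a \<Rightarrow> 'a"
  assumes br_closed: "\<lbrakk>a \<in> H; b \<in> H; c \<in> H\<rbrakk> \<Longrightarrow> br a b c \<in> H"
    and br_assoc:
      "\<lbrakk>a \<in> H; b \<in> H; c \<in> H; d \<in> H; e \<in> H\<rbrakk> \<Longrightarrow> br (br a b c) d e = br a b (br c d e)"
    and br_left_cancel: "\<lbrakk>a \<in> H; b \<in> H\<rbrakk> \<Longrightarrow> br b b a = a"
    and br_right_cancel: "\<lbrakk>a \<in> H; b \<in> H\<rbrakk> \<Longrightarrow> br a b b = a"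

locale abelian_heap = heap +
  assumes br_commute: "\<lbrakk>a \<in> H; b \<in> H; c \<in> H\<rbrakk> \<Longrightarrow> br a b c = br c b a"

locale truss = abelian_heap T br
  for T :: "'a set"
    and br :: "'a \<Rightarrow> 'a \<Rightarrow> 'a \<Rightarrow> 'a" +
  fixes mul :: "'a \<Rightarrow> 'a \<Rightarrow> 'a"
  assumes mul_closed: "\<lbrakk>a \<in> T; b \<in> T\<rbrakk> \<Longrightarrow> mul a b \<in> T"
    and mul_assoc: "\<lbrakk>a \<in> T; b \<in> T; c \<in> T\<rbrakk> \<Longrightarrow> mul (mul a b) c = mul a (mul b c)"
    and distrib_left:
      "\<lbrakk>a \<in> T; b \<in> T; c \<in> T; d \<in> T\<rbrakk> \<Longrightarrow> mul a (br b c d) = br (mul a b) (mul a c) (mul a d)"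
    and distrib_right:
      "\<lbrakk>a \<in> T; b \<in> T; c \<in> T; d \<in> T\<rbrakk> \<Longrightarrow> mul (br b c d) a = br (mul b a) (mul c a) (mul d a)"

locale left_truss_module = T: truss T brT mul + M: abelian_heap M brM
  for T :: "'a set"
    and brT :: "'a \<Rightarrow> 'a \<Rightarrow> 'a \<Rightarrow> 'a"
    and mul :: "'a \<Rightarrow> 'a \<Rightarrow> 'a"
    and M :: "'b set"
    and brM :: "'b \<Rightarrow> 'b \<Rightarrow> 'b \<Rightarrow> 'b" +
  fixes act :: "'a \<Rightarrow> 'b \<Rightarrow> 'b"
  assumes act_closed: "\<lbrakk>t \<in> T; m \<in> M\<rbrakk> \<Longrightarrow> act t m \<in> M"
    and act_mul: "\<lbrakk>t \<in> T; t' \<in> T; m \<in> M\<rbrakk> \<Longrightarrow> act t (act t' m) = act (mul t t') m"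
    and act_brT:
      "\<lbrakk>t \<in> T; t' \<in> T; t'' \<in> T; m \<in> M\<rbrakk>
        \<Longrightarrow> act (brT t t' t'') m = brM (act t m) (act t' m) (act t'' m)"
    and act_brM:
      "\<lbrakk>t \<in> T; m \<in> M; m' \<in> M; m'' \<in> M\<rbrakk>
        \<Longrightarrow> act t (brM m m' m'') = brM (act t m) (act t m') (act t m'')"

definition heap_prod_br ::
  "('a \<Rightarrow> 'a \<Rightarrow> 'a \<Rightarrow> 'a) \<Rightarrow> ('b \<Rightarrow> 'b \<Rightarrow> 'b \<Rightarrow> 'b)
    \<Rightarrow> 'a \<times> 'b \<Rightarrow> 'a \<times> 'b \<Rightarrow> 'a \<times> 'b \<Rightarrow> 'a \<times> 'b" where
  "heap_prod_br brT brM = (\<lambda>(t, m) (t', m') (t'', m''). (brT t t' t'', brM m m' m''))"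

definition truss_ext_mul ::
  "('a \<Rightarrow> 'a \<Rightarrow> 'a) \<Rightarrow> ('b \<Rightarrow> 'b \<Rightarrow> 'b \<Rightarrow> 'b) \<Rightarrow> ('a \<Rightarrow> 'b \<Rightarrow> 'b) \<Rightarrow> 'b
    \<Rightarrow> 'a \<times> 'b \<Rightarrow> 'a \<times> 'b \<Rightarrow> 'a \<times> 'b" where
  "truss_ext_mul mul brM act e = (\<lambda>(t, m) (t', m'). (mul t t', brM m (act t e) (act t m')))"

end

theory Submission
  imports Defs
begin

text \<open>
  In an abelian heap every bracket has a left-normed form in which the entries in odd positions, and
  likewise those in even positions, may be permuted freely; this gives the interchange law. Both
  distributive laws of the extension are instances of interchange, and its associativity is heap
  associativity.
\<close>

text \<open>Heap form of the rule that inverting a product reverses it. It flattens a bracket in the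
  middle slot, as associativity does in the third.\<close>

lemma (in heap) br_middle:
  assumes "a \<in> H" "b \<in> H" "c \<in> H" "d \<in> H" "e \<in> H"
  shows "br a (br b c d) e = br (br a d c) b e"
proof -
  let ?x = "br b c d"
  \<comment> \<open>Rewriting \<open>a\<close> as a bracket ending in \<open>?x\<close> puts two
    copies of \<open>?x\<close> side by side, where they cancel.\<close>
  have "br (br a d c) b ?x = br a d (br (br c b b) c d)"
    using assms by (simp add: br_assoc br_closed)
  also have "\<dots> = a"
    using assms by (simp add: br_left_cancel br_right_cancel)
  finally have "br a ?x e = br (br (br a d c) b ?x) ?x e"
    by simp
  also have "\<dots> = br (br a d c) b e"
    using assms by (simp add: br_assoc [of "br a d c" b ?x ?x e] br_closed br_left_cancel)
  finally show ?thesis .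
qed

context abelian_heap
begin

text \<open>By \<open>br_middle\<close> the two sides have middle entries \<open>br d c b\<close>
  and \<open>br b c d\<close>, which commutativity identifies.\<close>

lemma br_swap_even:
  assumes "a \<in> H" "b \<in> H" "c \<in> H" "d \<in> H" "e \<in> H"
  shows "br (br a b c) d e = br (br a d c) b e"
  using assms by (metis br_middle br_commute)

lemma br_swap_odd:
  assumes "a \<in> H" "b \<in> H" "c \<in> H" "d \<in> H" "e \<in> H"
  shows "br (br a b c) d e = br (br a b e) d c"
  using assms by (metis br_assoc br_commute)

lemma br_interchange:
  assumes "a \<in> H" "b \<in> H" "c \<in> H" "d \<in> H" "f \<in> H" "g \<in> H" "h \<in> H" "i \<in> H" "j \<in> H"
  shows "br (br a b c) (br d f g) (br h i j) = br (br a d h) (br b f i) (br c g j)"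
  using assms
  \<comment> \<open>Both sides flatten to left-normed brackets with head \<open>a\<close>, so swaps
    that fix the head suffice to sort them.\<close>
  by (simp add: br_closed br_middle br_assoc [symmetric] br_swap_even br_swap_odd)

end

theorem theorem4p2:
  fixes T :: "'a set"
    and brT :: "'a \<Rightarrow> 'a \<Rightarrow> 'a \<Rightarrow> 'a"
    and mul :: "'a \<Rightarrow> 'a \<Rightarrow> 'a"
    and M :: "'b set"
    and brM :: "'b \<Rightarrow> 'b \<Rightarrow> 'b \<Rightarrow> 'b"
    and act :: "'a \<Rightarrow> 'b \<Rightarrow> 'b"
    and e :: 'b
  assumes "truss T brT mul"
    and "left_truss_module T brT mul M brM act"
    and "e \<in> M"
  shows "truss (T \<times> M) (heap_prod_br brT brM) (truss_ext_mul mul brM act e)"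
proof -
  interpret left_truss_module T brT mul M brM act
    by fact
  note e = \<open>e \<in> M\<close>
  let ?br = "heap_prod_br brT brM" and ?mul = "truss_ext_mul mul brM act e"
  have br [simp]: "?br (t, m) (t', m') (t'', m'') = (brT t t' t'', brM m m' m'')"
    for t t' t'' m m' m''
    by (simp add: heap_prod_br_def)
  have mul [simp]: "?mul (t, m) (t', m') = (mul t t', brM m (act t e) (act t m'))" for t t' m m'
    by (simp add: truss_ext_mul_def)
  note closed = T.br_closed M.br_closed T.mul_closed act_closed
  show ?thesis
  proof (unfold_locales, goal_cases)
    case 1
    then show ?case by (auto simp: closed)
  next
    case 2
    then show ?case by (auto simp: T.br_assoc M.br_assoc)
  next
    case 3
    then show ?case by (auto simp: T.br_left_cancel M.br_left_cancel)
  next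
    case 4
    then show ?case by (auto simp: T.br_right_cancel M.br_right_cancel)
  next
    case 5
    then show ?case by (auto intro: T.br_commute M.br_commute)
  next
    case 6
    then show ?case using e by (auto simp: closed)
  next
    \<comment> \<open>Expanding the action turns the second components into
      \<open>[[m, te, tm'], tt'e, tt'm'']\<close> and
      \<open>[m, te, [tm', tt'e, tt'm'']]\<close>.\<close>
    case 7
    then show ?case
      using e by (auto simp: closed T.mul_assoc act_brM act_mul M.br_assoc)
  next
    case (8 x y z w)
    \<comment> \<open>Interchange applies once \<open>m\<close> and \<open>act t e\<close> are each
      read as the bracket of three copies of themselves.\<close>
    have "brM m (act t e) (brM p q r)
        = brM (brM m (act t e) p) (brM m (act t e) q) (brM m (act t e) r)"
      if "t \<in> T" "m \<in> M" "p \<in> M" "q \<in> M" "r \<in> M" for t m p q r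
      using that e M.br_interchange [of m "act t e" p m "act t e" q m "act t e" r]
      by (simp add: closed M.br_left_cancel)
    with 8 e show ?case
      by (auto simp: closed T.distrib_left act_brM)
  next
    case 9
    then show ?case
      using e by (auto simp: closed T.distrib_right act_brT M.br_interchange)
  qed
qed

end
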